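(* Let $N$ be a positive integer and let $\mu_1,\dots,\mu_N>0$. For any $P_1,\dots,P_N\in\mathbb{N}$ and any $\beta\ge 0$, there exists a number $\varepsilon_0=\varepsilon_0(\mu_1,\dots,\mu_N;P_1,\dots,P_N;\beta)>0$ such that, if $\beta_{ij}\in[-\varepsilon_0,\beta]$ for all $i,j=1,\dots,N$ with $i\neq j$, then there is no $(u_1,\dots,u_N)\ne(0,\dots,0)$ satisfying all of the following for $j=1,\dots,N$: $$-\Delta u_j=\mu_ju_j^3+\sum_{i\neq j}\beta_{ij}u_i^2u_j\ \text{ in }\mathbb{R}^3;$$ $u_j\in C^2(\mathbb{R}^3)$ and $u_j$ is radial; $u_j$ is identically zero or changes its sign at most $P_j$ times; and $|u_j|_{L^\infty(\mathbb{R}^3)}\le 1$.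
   Context: $\mathbb{N}=\{0,1,2,\dots\}$. For a continuous radial function $u$, the number of sign changes (number of nodes) $n(u)$ is the largest integer $k\ge 0$ for which there are radii $0<x_0<x_1<\dots<x_k$ with $u|_{|x|=x_j}\cdot u|_{|x|=x_{j+1}}<0$ for $j=0,\dots,k-1$; "$u$ changes its sign at most $P$ times" means $n(u)\le P$. *)

theory Defs
  imports
    "HOL-Analysis.Analysis"
    "HOL-Probability.Essential_Supremum"
    "HOL-Library.Extended_Nat"
begin

definition partial_deriv ::
    "'a::euclidean_space \<Rightarrow> ('a \<Rightarrow> real) \<Rightarrow> 'a \<Rightarrow> real" where
  "partial_deriv b u = (\<lambda>x. frechet_derivative u (at x) b)"

(* In finite dimensions, continuity of the derivative in operator norm is
   continuity of the partial derivatives along the standard basis. *)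
primrec C_k_real :: "nat \<Rightarrow> ('a::euclidean_space \<Rightarrow> real) \<Rightarrow> bool" where
  "C_k_real 0 u \<longleftrightarrow> continuous_on UNIV u"
| "C_k_real (Suc k) u \<longleftrightarrow>
     (\<forall>x. u differentiable (at x)) \<and> (\<forall>b\<in>Basis. C_k_real k (partial_deriv b u))"

definition laplacian :: "('a::euclidean_space \<Rightarrow> real) \<Rightarrow> 'a \<Rightarrow> real" where
  "laplacian u x = (\<Sum>b\<in>Basis. partial_deriv b (partial_deriv b u) x)"

definition radial :: "('a::euclidean_space \<Rightarrow> real) \<Rightarrow> bool" where
  "radial u \<longleftrightarrow> (\<forall>x y. norm x = norm y \<longrightarrow> u x = u y)"

(* The product of the values of u on two spheres is written with arbitrary points
   y, z of these spheres; for radial u the choice of points does not matter. *)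
definition has_sign_changes :: "('a::euclidean_space \<Rightarrow> real) \<Rightarrow> nat \<Rightarrow> bool" where
  "has_sign_changes u k \<longleftrightarrow>
     (\<exists>r :: nat \<Rightarrow> real. 0 < r 0 \<and> (\<forall>j<k. r j < r (Suc j)) \<and>
        (\<forall>j<k. \<forall>y z. norm y = r j \<longrightarrow> norm z = r (Suc j) \<longrightarrow> u y * u z < 0))"

(* k = 0 is always admissible, so the supremum is the largest admissible k when
   there is one, and infinity otherwise. *)
definition sign_changes :: "('a::euclidean_space \<Rightarrow> real) \<Rightarrow> enat" where
  "sign_changes u = (SUP k\<in>{k. has_sign_changes u k}. enat k)"

definition Linf_norm :: "('a::euclidean_space \<Rightarrow> real) \<Rightarrow> ereal" where
  "Linf_norm u = esssup lborel (\<lambda>x. ereal \<bar>u x\<bar>)"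

end

theory Submission
  imports Defs
begin

text \<open>In dimension three, \<open>- \<Delta>u = \<mu> u\<^sup>3\<close> has no nontrivial radial solution that changes sign only
  finitely often. Where \<open>u\<close> has a fixed sign up to infinity, \<open>v = r u\<close> is concave and positive, hence
  nondecreasing, and \<open>v'' = - \<mu> v\<^sup>3/r\<^sup>2\<close> gives \<open>v' \<ge> \<mu> v\<^sup>3/r\<close>. Therefore \<open>v\<close> to the power \<open>-2\<close> decreases at
  least like \<open>2 \<mu> ln r\<close>, which is impossible for a positive quantity. The same holds for each component of the
  system when all couplings are nonnegative, since they only increase the potential.

  To allow slightly negative couplings, this argument is made quantitative on finite intervals. After
  rescaling, the supremum of all components is 1, and some component is larger than one half at some point.
  For this component \<open>u j\<close> the system reads \<open>v'' = - V v\<close> with a bounded potential \<open>V\<close> that is at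
  least \<open>\<mu> j (u j)\<^sup>2 - \<epsilon>\<close>. Two facts are then played against each other.

  \<^item> By Gronwall's inequality (\<open>energy_decay_bound\<close>) the energy \<open>v\<^sup>2 + v'\<^sup>2\<close> cannot become too small
    within a given distance.
  \<^item> A solution that keeps its sign on a sufficiently long interval has small energy at
    the beginning of this interval (\<open>nonneg_solution_start_small\<close>), provided that \<open>\<epsilon>\<close> is small enough.

  Hence \<open>v\<close> takes both signs in each of \<open>P j + 1\<close> consecutive windows of suitable lengths
  (\<open>reduced_profile_negative_in_window\<close>), and this makes \<open>P j + 1\<close> sign changes, one too many.
  The lengths and the admissible \<open>\<epsilon>\<close> depend only on \<open>\<mu> j\<close>, on the bound for \<open>V\<close> and on
  \<open>P j\<close>, but not on the point where \<open>u j\<close> is large, because a shifted profile divided by the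
  starting radius satisfies the same inequalities.\<close>

section \<open>Solutions of fixed sign on long intervals\<close>

lemma increment_mono:
  fixes f g :: "real \<Rightarrow> real"
  assumes "a \<le> b"
    and "\<And>x. x \<in> {a..b} \<Longrightarrow> (f has_real_derivative f' x) (at x)"
    and "\<And>x. x \<in> {a..b} \<Longrightarrow> (g has_real_derivative g' x) (at x)"
    and "\<And>x. x \<in> {a..b} \<Longrightarrow> f' x \<le> g' x"
  shows "f b - f a \<le> g b - g a"
proof -
  have "(\<lambda>x. g x - f x) a \<le> (\<lambda>x. g x - f x) b"
  proof (rule DERIV_nonneg_imp_nondecreasing[OF \<open>a \<le> b\<close>])
    fix x assume "a \<le> x" "x \<le> b"
    then show "\<exists>y. ((\<lambda>x. g x - f x) has_real_derivative y) (at x) \<and> 0 \<le> y"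
      using assms(2-4)[of x] by (intro exI[of _ "g' x - f' x"]) (auto intro: DERIV_diff)
  qed
  then show ?thesis by simp
qed

lemma increment_ge:
  fixes f :: "real \<Rightarrow> real"
  assumes "a \<le> b" "\<And>x. x \<in> {a..b} \<Longrightarrow> (f has_real_derivative f' x) (at x)"
    and "\<And>x. x \<in> {a..b} \<Longrightarrow> m \<le> f' x"
  shows "m * (b - a) \<le> f b - f a"
proof -
  have "((\<lambda>x. m * x) has_real_derivative m) (at x)" for x
    by (auto intro!: derivative_eq_intros)
  from increment_mono[OF assms(1) this assms(2,3)] show ?thesis
    by (simp add: algebra_simps)
qed

lemma increment_le:
  fixes f :: "real \<Rightarrow> real"
  assumes "a \<le> b" "\<And>x. x \<in> {a..b} \<Longrightarrow> (f has_real_derivative f' x) (at x)"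
    and "\<And>x. x \<in> {a..b} \<Longrightarrow> f' x \<le> m"
  shows "f b - f a \<le> m * (b - a)"
proof -
  have "((\<lambda>x. m * x) has_real_derivative m) (at x)" for x
    by (auto intro!: derivative_eq_intros)
  from increment_mono[OF assms(1,2) this assms(3)] show ?thesis
    by (simp add: algebra_simps)
qed

text \<open>The function \<open>-1/(2 y\<^sup>2)\<close> grows at least like \<open>(\<mu>/32) ln t\<close>, yet it starts above \<open>-1/(2 c\<^sup>2)\<close> and
  stays negative. So the logarithm has only a bounded room to grow, and \<open>S\<close> is chosen to exceed it.
  This is where the cubic power in dimension three is decisive: after the substitution
  \<open>y = r u\<close> the equation reads \<open>y'' = - \<mu> y\<^sup>3/t\<^sup>2\<close>, and the tail of \<open>1/t\<^sup>2\<close> is \<open>1/t\<close>, whose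
  integral just diverges.\<close>

lemma logarithmic_exhaustion:
  fixes y y' :: "real \<Rightarrow> real"
  assumes "c > 0" "\<mu> > 0" and S: "S = 4 * exp (16 / (\<mu> * c\<^sup>2) + 1)"
    and der: "\<And>t. t \<in> {2..S/2} \<Longrightarrow> (y has_real_derivative y' t) (at t)"
    and low: "\<And>t. t \<in> {2..S/2} \<Longrightarrow> c \<le> y t"
    and gr: "\<And>t. t \<in> {2..S/2} \<Longrightarrow> \<mu> * y t ^ 3 / (32 * t) \<le> y' t"
  shows False
proof -
  have S4: "S \<ge> 4" using assms(1,2) unfolding S by simp
  have "\<mu>/32 * ln (S/2) - \<mu>/32 * ln 2 \<le> -1/(2*(y (S/2))\<^sup>2) - -1/(2*(y 2)\<^sup>2)"
  proof (rule increment_mono[where f' = "\<lambda>t. \<mu>/(32*t)" and g' = "\<lambda>t. y' t / y t ^ 3"])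
    show "2 \<le> S/2" using S4 by simp
  next
    fix t assume t: "t \<in> {2..S/2}"
    then have yt: "y t > 0" using low[OF t] \<open>c > 0\<close> by linarith
    show "((\<lambda>t. \<mu>/32 * ln t) has_real_derivative \<mu>/(32*t)) (at t)"
      using t by (auto intro!: derivative_eq_intros)
    show "((\<lambda>t. -1/(2*(y t)\<^sup>2)) has_real_derivative y' t / y t ^ 3) (at t)"
      using yt by (auto intro!: derivative_eq_intros der[OF t] simp: field_simps power2_eq_square power3_eq_cube)
    show "\<mu>/(32*t) \<le> y' t / y t ^ 3"
      using gr[OF t] yt t by (simp add: field_simps)
  qed
  also have "\<dots> \<le> 1/(2*(y 2)\<^sup>2)" by simp
  also have "\<dots> \<le> 1/(2*c\<^sup>2)"
    using low[of 2] S4 \<open>c > 0\<close> by (auto intro!: divide_left_mono mult_pos_pos power_mono simp: power_mono)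
  finally have "\<mu>/32 * (ln (S/2) - ln 2) \<le> 1/(2*c\<^sup>2)" by (simp add: algebra_simps)
  moreover have "ln (S/2) - ln 2 = 16 / (\<mu> * c\<^sup>2) + 1"
  proof -
    have "ln (S/2) - ln 2 = ln (S/4)" using S4 ln_div[of "S/2" 2] by simp
    then show ?thesis by (simp add: S)
  qed
  ultimately have "\<mu>/32 * (16 / (\<mu> * c\<^sup>2) + 1) \<le> 1/(2*c\<^sup>2)" by simp
  moreover have "\<mu>/32 * (16 / (\<mu> * c\<^sup>2) + 1) = 1/(2*c\<^sup>2) + \<mu>/32"
    using assms(1,2) by (simp add: field_simps)
  ultimately show False using \<open>\<mu> > 0\<close> by simp
qed

text \<open>An almost concave function that never decreases faster than the tiny rate \<open>\<kappa>\<close> stays above half of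
  its present value until time \<open>S\<close>. Integrating \<open>y'' \<le> - \<mu> y\<^sup>3/t\<^sup>2\<close> from \<open>t\<close> to \<open>S\<close> then shows
  that \<open>y' t\<close> must have been at least of order \<open>\<mu> (y t)\<^sup>3/t\<close>: otherwise the slope at \<open>S\<close> would be
  too negative. This is the growth that \<open>logarithmic_exhaustion\<close> rules out.\<close>

lemma nonneg_solution_escapes_below:
  fixes y y' y'' :: "real \<Rightarrow> real"
  assumes pos: "c > 0" "\<mu> > 0" and S: "S = 4 * exp (16 / (\<mu> * c\<^sup>2) + 1)"
    and kap: "\<kappa> \<ge> 0" "\<kappa> \<le> c/(2*S)" "\<kappa> \<le> \<mu> * c^3/(64*S)"
    and eps: "\<epsilon> * S\<^sup>2 \<le> \<kappa>" "\<epsilon> \<ge> 0"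
    and y: "\<And>t. t \<in> {2..S} \<Longrightarrow> (y has_real_derivative y' t) (at t)"
    and y': "\<And>t. t \<in> {2..S} \<Longrightarrow> (y' has_real_derivative y'' t) (at t)"
    and y'': "\<And>t. t \<in> {2..S} \<Longrightarrow> y'' t \<le> - \<mu> * y t ^ 3 / t\<^sup>2 + \<epsilon> * S"
    and low: "\<And>t. t \<in> {2..S} \<Longrightarrow> c \<le> y t"
    and slope: "\<And>t. t \<in> {2..S} \<Longrightarrow> - \<kappa> \<le> y' t"
  shows False
proof (rule logarithmic_exhaustion[OF pos S])
  have S4: "S \<ge> 4" using pos unfolding S by simp
  fix t assume t: "t \<in> {2..S/2}"
  then have tS: "t \<in> {2..S}" using S4 by auto
  show "(y has_real_derivative y' t) (at t)" "c \<le> y t" using y low tS by auto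
  have later: "y t / 2 \<le> y s" if s: "s \<in> {t..S}" for s
  proof -
    have "- \<kappa> * (s - t) \<le> y s - y t"
      by (rule increment_ge[where f' = y']) (use s t y slope in auto)
    moreover have "\<kappa> * (s - t) \<le> c/(2*S) * S"
      using s t kap S4 by (intro mult_mono) auto
    ultimately show ?thesis using low[OF tS] S4 by (simp add: field_simps)
  qed
  \<comment> \<open>\<open>q\<close> bounds \<open>\<mu> (y s)\<^sup>3\<close> from below for all \<open>s\<close> between \<open>t\<close> and \<open>S\<close>.\<close>
  define q where "q = \<mu> * y t ^ 3 / 8"
  have yt: "y t > 0" using low[OF tS] pos by linarith
  have "y' S - y' t \<le> (q / S + \<epsilon> * S * S) - (q / t + \<epsilon> * S * t)"
  proof (rule increment_mono[where f' = y'' and g' = "\<lambda>s. - q / s\<^sup>2 + \<epsilon> * S"])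
    fix s assume s: "s \<in> {t..S}"
    show "(y' has_real_derivative y'' s) (at s)" using y' s t by auto
    show "((\<lambda>s. q / s + \<epsilon> * S * s) has_real_derivative - q / s\<^sup>2 + \<epsilon> * S) (at s)"
      using s t by (auto intro!: derivative_eq_intros simp: power2_eq_square)
    have "(y t / 2)^3 \<le> y s ^ 3" using later[OF s] yt by (intro power_mono) auto
    then have "q \<le> \<mu> * y s ^ 3"
      using pos by (simp add: q_def power_divide)
    then have "q / s\<^sup>2 \<le> \<mu> * y s ^ 3 / s\<^sup>2" by (intro divide_right_mono) auto
    then show "y'' s \<le> - q / s\<^sup>2 + \<epsilon> * S" using y''[of s] s t by auto
  qed (use t in auto)
  moreover have "- \<kappa> \<le> y' S" using slope S4 by auto
  moreover have "\<epsilon> * S * S - \<epsilon> * S * t \<le> \<kappa>"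
  proof -
    have "0 \<le> \<epsilon> * S * t" using eps S4 t by auto
    then show ?thesis using eps by (simp add: power2_eq_square)
  qed
  moreover have "q / S \<le> q / (2 * t)"
    using t S4 pos yt by (intro divide_left_mono) (auto simp: q_def)
  ultimately have "q / (2 * t) - 2 * \<kappa> \<le> y' t" by (simp add: field_simps)
  moreover have "2 * \<kappa> \<le> q / (4 * t)"
  proof -
    have "c ^ 3 \<le> y t ^ 3" using low[OF tS] pos by (intro power_mono) auto
    then have "\<mu> * c ^ 3 \<le> \<mu> * y t ^ 3" using pos by simp
    then have "2 * \<kappa> \<le> \<mu> * y t ^ 3 / (32 * S)"
      using kap S4 by (simp add: field_simps)
    also have "\<dots> \<le> \<mu> * y t ^ 3 / (32 * t)"
      using t S4 pos yt by (intro divide_left_mono) auto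
    finally show ?thesis by (simp add: q_def)
  qed
  ultimately have "q / (2 * t) - q / (4 * t) \<le> y' t" by linarith
  then show "\<mu> * y t ^ 3 / (32 * t) \<le> y' t" by (simp add: q_def field_simps)
qed

text \<open>A nonnegative solution on a long interval must start close to zero, in value and in slope.
  The bound \<open>y t \<le> t\<close> together with \<open>0 \<le> y T\<close> for a huge \<open>T\<close> forbids, by near-concavity, any
  noticeable negative slope on \<open>{1..S}\<close>: a solution that sinks would cross zero before \<open>T\<close>. Hence a
  start of size \<open>d\<close> keeps the solution above a constant \<open>c\<close> (a large initial slope lifts it to this
  height shortly after time 1), and it meets the hypotheses of \<open>nonneg_solution_escapes_below\<close>.
  The constants are chosen in the order \<open>h\<close>, \<open>c\<close>, \<open>S\<close>, \<open>\<kappa>\<close>, \<open>T\<close>, \<open>\<epsilon>\<close>, each depending on the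
  previous ones.\<close>

lemma nonneg_solution_start_small:
  fixes \<mu> K d :: real
  assumes "\<mu> > 0" "K \<ge> 0" "d > 0"
  shows "\<exists>T>1. \<exists>\<epsilon>>0. \<forall>y y' V :: real \<Rightarrow> real.
    (\<forall>t\<in>{1..T}. (y has_real_derivative y' t) (at t) \<and>
       (y' has_real_derivative - V t * y t) (at t) \<and>
       0 \<le> y t \<and> y t \<le> t \<and> \<bar>V t\<bar> \<le> K \<and> \<mu> * (y t)\<^sup>2 / t\<^sup>2 - \<epsilon> \<le> V t)
    \<longrightarrow> y 1 < d \<and> \<bar>y' 1\<bar> < d"
proof -
  \<comment> \<open>During the time \<open>h\<close> after 1 an initial slope of \<open>d\<close> loses at most half of its size.\<close>
  define h where "h = min 1 (d / (4 * (K + 1)))"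
  have h: "0 < h" "h \<le> 1" "2 * K * h \<le> d / 2"
  proof -
    show "0 < h" "h \<le> 1" using assms by (auto simp: h_def)
    have "2 * K * h \<le> 2 * (K+1) * (d / (4 * (K + 1)))"
      using assms by (intro mult_mono) (auto simp: h_def)
    also have "\<dots> = d / 2" using assms by (simp add: field_simps)
    finally show "2 * K * h \<le> d / 2" .
  qed
  define c where "c = h * d / 4"
  have c: "c > 0" "c \<le> d / 4" using h assms by (auto simp: c_def mult_le_cancel_right1)
  define S where "S = 4 * exp (16 / (\<mu> * c\<^sup>2) + 1)"
  have S4: "S \<ge> 4" using c assms by (simp add: S_def)
  define \<kappa> where "\<kappa> = min (c/(2*S)) (\<mu> * c^3/(64*S))"
  have kap: "\<kappa> > 0" "\<kappa> \<le> c/(2*S)" "\<kappa> \<le> \<mu> * c^3/(64*S)"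
    using c S4 assms by (auto simp: \<kappa>_def)
  define T where "T = S + 2 * S / \<kappa>"
  have T: "T > S" using kap S4 by (simp add: T_def)
  define \<epsilon> where "\<epsilon> = \<kappa> / (2 * T\<^sup>2)"
  have eps: "\<epsilon> > 0" using kap T S4 by (simp add: \<epsilon>_def)
  have epsT: "\<epsilon> * T * T = \<kappa> / 2" using T S4 by (simp add: \<epsilon>_def power2_eq_square)
  have False if sol: "\<forall>t\<in>{1..T}. (y has_real_derivative y' t) (at t) \<and>
       (y' has_real_derivative - V t * y t) (at t) \<and>
       0 \<le> y t \<and> y t \<le> t \<and> \<bar>V t\<bar> \<le> K \<and> \<mu> * (y t)\<^sup>2 / t\<^sup>2 - \<epsilon> \<le> V t"
      and large: "y 1 \<ge> d \<or> \<bar>y' 1\<bar> \<ge> d" for y y' V :: "real \<Rightarrow> real"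
  proof -
    have y'': "- V t * y t \<le> - \<mu> * y t ^ 3 / t\<^sup>2 + \<epsilon> * t" if "t \<in> {1..T}" for t
    proof -
      have *: "0 \<le> y t" "y t \<le> t" "\<mu> * (y t)\<^sup>2 / t\<^sup>2 - \<epsilon> \<le> V t" using sol that by auto
      have "(\<mu> * (y t)\<^sup>2 / t\<^sup>2 - \<epsilon>) * y t \<le> V t * y t" using * by (intro mult_right_mono) auto
      moreover have "\<epsilon> * y t \<le> \<epsilon> * t" using * eps by simp
      ultimately show ?thesis by (simp add: algebra_simps power2_eq_square power3_eq_cube)
    qed
    \<comment> \<open>A slope below \<open>- \<kappa>\<close> at time \<open>t\<close> would persist, up to \<open>\<kappa> / 2\<close>, until \<open>T\<close>;\<close>
    \<comment> \<open>since \<open>y t \<le> S\<close>, this would make \<open>y T\<close> negative.\<close>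
    have slope: "- \<kappa> \<le> y' t" if t: "t \<in> {1..S}" for t
    proof -
      have up: "y' s \<le> y' t + \<kappa> / 2" if s: "s \<in> {t..T}" for s
      proof -
        have "y' s - y' t \<le> \<epsilon> * T * (s - t)"
        proof (rule increment_le[where f' = "\<lambda>s. - V s * y s"])
          fix r assume r: "r \<in> {t..s}"
          then have "0 \<le> \<mu> * y r ^ 3 / r\<^sup>2" using sol s t assms by auto
          moreover have "\<epsilon> * r \<le> \<epsilon> * T" using r s eps by simp
          ultimately show "- V r * y r \<le> \<epsilon> * T" using y''[of r] r s t by auto
        qed (use s t sol in auto)
        also have "\<dots> \<le> \<epsilon> * T * T" using s t T eps S4 by (intro mult_left_mono) auto
        finally show ?thesis using epsT by simp
      qed
      have "y T - y t \<le> (y' t + \<kappa> / 2) * (T - t)"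
        by (rule increment_le[where f' = y']) (use t T sol up in auto)
      moreover have "0 \<le> y T" "y t \<le> S" using sol t T S4 by (force)+
      ultimately have "- S \<le> (y' t + \<kappa> / 2) * (T - t)" by linarith
      moreover have "(y' t + \<kappa> / 2) * (T - t) < - S" if "y' t < - \<kappa>"
      proof -
        have "(y' t + \<kappa> / 2) * (T - t) < (- \<kappa> / 2) * (T - t)"
          using that t T by (intro mult_strict_right_mono) auto
        also have "\<dots> \<le> (- \<kappa> / 2) * (T - S)"
          using t kap by (intro mult_left_mono_neg) auto
        also have "\<dots> = - S" using kap by (simp add: T_def)
        finally show ?thesis .
      qed
      ultimately show ?thesis by linarith
    qed
    have drift: "y s - c \<le> y t" if "s \<in> {1..t}" "t \<le> S" for s t
    proof -
      have "- \<kappa> * (t - s) \<le> y t - y s"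
        by (rule increment_ge[where f' = y']) (use that T sol slope in auto)
      moreover have "\<kappa> * (t - s) \<le> c/(2*S) * S"
        using that kap c S4 by (intro mult_mono) auto
      ultimately show ?thesis using S4 c by simp
    qed
    \<comment> \<open>A solution of height \<open>2 c\<close> at some time up to 2 stays above \<open>c\<close> until \<open>S\<close>, by \<open>drift\<close>.\<close>
    have "\<exists>s\<in>{1..2}. 2 * c \<le> y s"
    proof (cases "y 1 \<ge> d")
      case True
      then show ?thesis using c by (intro bexI[of _ 1]) auto
    next
      case False
      have "c/(2*S) \<le> c" using c S4 by (simp add: field_simps)
      then have "- d < y' 1" using slope[of 1] kap c S4 by auto
      then have d1: "d \<le> y' 1" using False large by auto
      have d2: "d / 2 \<le> y' t" if t: "t \<in> {1..1+h}" for t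
      proof -
        have "- 2 * K * (t - 1) \<le> y' t - y' 1"
        proof (rule increment_ge[where f' = "\<lambda>s. - V s * y s"])
          fix r assume r: "r \<in> {1..t}"
          then have rT: "r \<in> {1..T}" and r2: "r \<le> 2" using t h T S4 by auto
          then have "V r * y r \<le> K * 2" using sol assms
            by (intro mult_mono) force+
          then show "- 2 * K \<le> - V r * y r" by simp
        qed (use t h T S4 sol in auto)
        moreover have "2 * K * (t - 1) \<le> 2 * K * h" using t assms by (intro mult_left_mono) auto
        ultimately show ?thesis using d1 h(3) by linarith
      qed
      have "d / 2 * (1 + h - 1) \<le> y (1 + h) - y 1"
        by (rule increment_ge[where f' = y']) (use d2 sol h T S4 in auto)
      moreover have "0 \<le> y 1" using sol T S4 by auto
      ultimately show ?thesis using h by (intro bexI[of _ "1 + h"]) (auto simp: c_def)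
    qed
    then obtain s where s: "s \<in> {1..2}" "2 * c \<le> y s" by blast
    show False
    proof (rule nonneg_solution_escapes_below[where y = y and y' = y' and c = c and \<mu> = \<mu>
            and \<kappa> = \<kappa> and \<epsilon> = \<epsilon> and S = S and y'' = "\<lambda>t. - V t * y t"])
      have "\<epsilon> * S\<^sup>2 \<le> \<epsilon> * T\<^sup>2" using eps T S4 by (intro mult_left_mono power_mono) auto
      then show "\<epsilon> * S\<^sup>2 \<le> \<kappa>" using epsT kap by (simp add: power2_eq_square)
    next
      fix t assume t: "t \<in> {2..S}"
      have "\<epsilon> * t \<le> \<epsilon> * S" using t eps by simp
      then show "- V t * y t \<le> - \<mu> * y t ^ 3 / t\<^sup>2 + \<epsilon> * S" using y''[of t] t T by auto
      show "c \<le> y t" using drift[of s t] s t by auto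
    qed (use c assms S_def kap eps sol T slope in auto)
  qed
  note contra = this
  show ?thesis
  proof (rule exI[of _ T], rule conjI, use T S4 in simp, rule exI[of _ \<epsilon>], rule conjI, rule eps, intro allI impI)
    fix y y' V :: "real \<Rightarrow> real"
    assume "\<forall>t\<in>{1..T}. (y has_real_derivative y' t) (at t) \<and>
       (y' has_real_derivative - V t * y t) (at t) \<and>
       0 \<le> y t \<and> y t \<le> t \<and> \<bar>V t\<bar> \<le> K \<and> \<mu> * (y t)\<^sup>2 / t\<^sup>2 - \<epsilon> \<le> V t"
    from contra[OF this] show "y 1 < d \<and> \<bar>y' 1\<bar> < d" by (meson not_less)
  qed
qed

section \<open>Oscillation of reduced radial profiles\<close>

text \<open>Each window offers both signs, so one can pick two points of opposite sign in the first window and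
  then, in each later one, a point whose sign is opposite to that of the last point chosen.\<close>

lemma alternating_points:
  fixes tau :: "nat \<Rightarrow> real" and f :: "real \<Rightarrow> real"
  assumes "\<And>i. i \<le> P \<Longrightarrow> \<exists>x\<in>{tau i..tau (Suc i)}. f x > 0"
    and "\<And>i. i \<le> P \<Longrightarrow> \<exists>x\<in>{tau i..tau (Suc i)}. f x < 0"
  shows "\<exists>p. tau 0 \<le> p 0 \<and> p (Suc P) \<le> tau (Suc P) \<and>
    (\<forall>j\<le>P. p j < p (Suc j) \<and> f (p j) * f (p (Suc j)) < 0)"
  using assms
proof (induction P)
  case 0
  obtain x y where x: "x \<in> {tau 0..tau (Suc 0)}" "f x > 0" and y: "y \<in> {tau 0..tau (Suc 0)}" "f y < 0"
    using 0 by blast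
  then have "x \<noteq> y" by auto
  then show ?case
    using x y
    by (intro exI[of _ "\<lambda>n. if n = 0 then min x y else max x y"])
      (auto simp: min_def max_def mult_neg_pos mult_pos_neg)
next
  case (Suc P)
  then obtain p where p: "tau 0 \<le> p 0" "p (Suc P) \<le> tau (Suc P)"
    "\<And>j. j \<le> P \<Longrightarrow> p j < p (Suc j) \<and> f (p j) * f (p (Suc j)) < 0"
    by (metis le_Suc_eq)
  have nz: "f (p (Suc P)) \<noteq> 0" using p(3)[of P] by auto
  have "\<exists>x\<in>{tau (Suc P)..tau (Suc (Suc P))}. f (p (Suc P)) * f x < 0"
    using Suc.prems(1,2)[of "Suc P"] nz by (cases "f (p (Suc P)) > 0") (auto simp: mult_less_0_iff)
  then obtain x where x: "x \<in> {tau (Suc P)..tau (Suc (Suc P))}" "f (p (Suc P)) * f x < 0" by blast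
  then have "x \<noteq> p (Suc P)" by (auto simp: mult_less_0_iff)
  then have "p (Suc P) < x" using x p(2) by auto
  then show ?case
    using p x by (intro exI[of _ "p(Suc (Suc P) := x)"]) (auto simp: le_Suc_eq)
qed

text \<open>Gronwall's inequality for the energy \<open>v\<^sup>2 + v'\<^sup>2\<close>: a bounded potential can damp it at most
  exponentially. It makes the unique continuation property quantitative, since a solution with
  large energy at one point cannot be tiny on a later interval.\<close>

lemma energy_decay_bound:
  fixes v v' V :: "real \<Rightarrow> real"
  assumes "a \<le> b"
    and v: "\<And>r. r \<in> {a..b} \<Longrightarrow> (v has_real_derivative v' r) (at r)"
    and v': "\<And>r. r \<in> {a..b} \<Longrightarrow> (v' has_real_derivative - V r * v r) (at r)"
    and V: "\<And>r. r \<in> {a..b} \<Longrightarrow> \<bar>V r\<bar> \<le> K"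
  shows "((v a)\<^sup>2 + (v' a)\<^sup>2) * exp (- (1 + K) * (b - a)) \<le> (v b)\<^sup>2 + (v' b)\<^sup>2"
proof -
  define E where "E r = (v r)\<^sup>2 + (v' r)\<^sup>2" for r
  have "0 * (b - a) \<le> E b * exp ((1 + K) * b) - E a * exp ((1 + K) * a)"
  proof (rule increment_ge[OF \<open>a \<le> b\<close>])
    fix r assume r: "r \<in> {a..b}"
    show "((\<lambda>r. E r * exp ((1 + K) * r)) has_real_derivative
      (2 * v r * v' r * (1 - V r) + (1 + K) * E r) * exp ((1 + K) * r)) (at r)"
      unfolding E_def
      by (auto intro!: derivative_eq_intros v[OF r] v'[OF r] simp: algebra_simps)
    have "\<bar>2 * v r * v' r\<bar> \<le> E r"
      using sum_squares_bound[of "v r" "v' r"] sum_squares_bound[of "v r" "- v' r"]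
      by (auto simp: E_def abs_if)
    moreover have "\<bar>1 - V r\<bar> \<le> 1 + K" using V[OF r] by auto
    ultimately have "\<bar>2 * v r * v' r * (1 - V r)\<bar> \<le> E r * (1 + K)"
      unfolding abs_mult[of "2 * v r * v' r"] by (intro mult_mono) (auto simp: E_def)
    then have "0 \<le> 2 * v r * v' r * (1 - V r) + (1 + K) * E r" by (simp add: abs_le_iff algebra_simps)
    then show "0 \<le> (2 * v r * v' r * (1 - V r) + (1 + K) * E r) * exp ((1 + K) * r)" by simp
  qed
  then have "E a * exp ((1 + K) * a) * exp (- (1 + K) * b) \<le> E b * exp ((1 + K) * b) * exp (- (1 + K) * b)"
    by (intro mult_right_mono) auto
  then show ?thesis by (simp add: E_def mult.assoc exp_add[symmetric] algebra_simps)
qed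

text \<open>The radial equation \<open>- \<Delta>u = V u\<close> in dimension three, written for \<open>v r = r u(r)\<close> with \<open>\<bar>u\<bar> \<le> 1\<close>.
  The last two conditions are all that is retained of the form of \<open>V\<close> in the system: it is
  bounded, and it dominates \<open>\<mu> u\<^sup>2\<close> up to the small error caused by the negative couplings.\<close>

definition reduced_profile ::
    "real \<Rightarrow> real \<Rightarrow> real \<Rightarrow> (real \<Rightarrow> real) \<Rightarrow> (real \<Rightarrow> real) \<Rightarrow> (real \<Rightarrow> real) \<Rightarrow> bool" where
  "reduced_profile \<mu> K \<epsilon> v v' V \<longleftrightarrow>
     (\<forall>r>0. (v has_real_derivative v' r) (at r) \<and> (v' has_real_derivative - V r * v r) (at r) \<and>
        \<bar>v r\<bar> \<le> r \<and> \<bar>V r\<bar> \<le> K \<and> \<mu> * (v r)\<^sup>2 / r\<^sup>2 - \<epsilon> \<le> V r)"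

lemma reduced_profile_uminus:
  "reduced_profile \<mu> K \<epsilon> v v' V \<Longrightarrow> reduced_profile \<mu> K \<epsilon> (\<lambda>r. - v r) (\<lambda>r. - v' r) V"
  unfolding reduced_profile_def
  by (auto intro!: derivative_eq_intros)

text \<open>If \<open>u = v/r\<close> is of size one half at \<open>r0\<close>, then the energy of \<open>v\<close> is of order \<open>1 + s\<^sup>2\<close> at some \<open>s\<close>.
  For \<open>r0 \<ge> 1\<close> the value of \<open>v\<close> at \<open>r0\<close> suffices. For small \<open>r0\<close> this value is small, but \<open>\<bar>v r\<bar> \<le> r\<close>
  forces \<open>v\<close> to change by at least \<open>r0/4\<close> between \<open>r0/4\<close> and \<open>r0\<close>, so its slope is of order one
  somewhere in between.
  The quadratic growth in \<open>s\<close> makes up for the division of \<open>v\<close> by the radius that a comparison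
  uniform in \<open>s\<close> requires.\<close>

lemma reduced_profile_energetic_start:
  assumes v: "reduced_profile \<mu> K \<epsilon> v v' V" and r0: "r0 > 0" "r0 / 2 \<le> \<bar>v r0\<bar>"
  shows "\<exists>s>0. 1 + s\<^sup>2 \<le> 18 * ((v s)\<^sup>2 + (v' s)\<^sup>2)"
proof (cases "r0 \<ge> 1")
  case True
  have "(r0 / 2)\<^sup>2 \<le> \<bar>v r0\<bar>\<^sup>2" using r0 by (intro power_mono) auto
  then have "r0\<^sup>2 \<le> 4 * (v r0)\<^sup>2" by (simp add: power_divide)
  moreover have "1 \<le> r0\<^sup>2" using True by (simp add: one_le_power)
  ultimately have "1 + r0\<^sup>2 \<le> 18 * ((v r0)\<^sup>2 + (v' r0)\<^sup>2)"
    unfolding distrib_left using zero_le_power2[of "v' r0"] by linarith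
  then show ?thesis using r0 by blast
next
  case False
  have "\<exists>z. r0/4 < z \<and> z < r0 \<and> v r0 - v (r0/4) = (r0 - r0/4) * v' z"
    using r0 v by (intro MVT2) (auto simp: reduced_profile_def)
  then obtain z where z: "r0/4 < z" "z < r0" "v r0 - v (r0/4) = (3/4 * r0) * v' z" by auto
  have "\<bar>v (r0/4)\<bar> \<le> r0/4" using v r0(1) unfolding reduced_profile_def
    by (metis divide_pos_pos zero_less_numeral)
  then have "r0/4 \<le> \<bar>(3/4 * r0) * v' z\<bar>" using r0 z(3) by linarith
  then have "r0 * (1/4) \<le> r0 * (3/4 * \<bar>v' z\<bar>)" using r0 by (simp add: abs_mult)
  then have "1/3 \<le> \<bar>v' z\<bar>" using r0 by simp
  then have "(1/3)\<^sup>2 \<le> \<bar>v' z\<bar>\<^sup>2" by (intro power_mono) auto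
  then have "1 \<le> 9 * (v' z)\<^sup>2" by (simp add: power_divide)
  moreover have "z\<^sup>2 \<le> 1" using z r0 False by (intro power_le_one) auto
  ultimately have "1 + z\<^sup>2 \<le> 18 * ((v z)\<^sup>2 + (v' z)\<^sup>2)"
    unfolding distrib_left using zero_le_power2[of "v z"] by linarith
  moreover have "z > 0" using z r0 by linarith
  ultimately show ?thesis by blast
qed

text \<open>The window is \<open>{a..a+L}\<close> with \<open>a = s + l\<close>. If \<open>v\<close> were nonnegative there, then the rescaled shift
  \<open>y t = v (a - 1 + t)/a\<close> would satisfy the hypotheses of \<open>nonneg_solution_start_small\<close>: the inequality
  \<open>a - 1 + t \<le> a t\<close> yields both \<open>y t \<le> t\<close> and the lower bound for the potential.
  Thus one length \<open>L\<close> serves for all \<open>s\<close>, near the origin (where the problem is genuinely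
  three-dimensional) as well as far away (where it is close to the one-dimensional problem). A
  small start of \<open>y\<close> contradicts the energy that \<open>energy_decay_bound\<close> carries from \<open>s\<close> to \<open>a\<close>.\<close>

lemma reduced_profile_negative_in_window:
  fixes \<mu> K l :: real
  assumes "\<mu> > 0" "K \<ge> 0" "l \<ge> 1"
  shows "\<exists>L>0. \<exists>\<epsilon>>0. \<forall>v v' V s. reduced_profile \<mu> K \<epsilon> v v' V \<longrightarrow> s > 0 \<longrightarrow>
    1 + s\<^sup>2 \<le> 18 * ((v s)\<^sup>2 + (v' s)\<^sup>2) \<longrightarrow> (\<exists>x\<in>{s+l..s+(l+L)}. v x < 0)"
proof -
  \<comment> \<open>Chosen so that \<open>2 d\<^sup>2 a\<^sup>2\<close> stays below the energy left at \<open>a\<close>, using\<close>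
  \<comment> \<open>\<open>a\<^sup>2 \<le> 2 l\<^sup>2 (1 + s\<^sup>2)\<close>; the factor 9 works since \<open>4/81 < 1/18\<close>.\<close>
  define d where "d = exp (- (1 + K) * l / 2) / (9 * l)"
  have d: "d > 0" using assms by (simp add: d_def)
  have d2: "d\<^sup>2 = exp (- (1 + K) * l) / (81 * l\<^sup>2)"
    by (simp add: d_def power_divide power_mult_distrib exp_double[symmetric] flip: exp_of_nat_mult)
  obtain T \<epsilon> where T: "T > 1" "\<epsilon> > 0" and small: "\<And>y y' V :: real \<Rightarrow> real.
    \<lbrakk>\<And>t. t\<in>{1..T} \<Longrightarrow> (y has_real_derivative y' t) (at t) \<and>
       (y' has_real_derivative - V t * y t) (at t) \<and>
       0 \<le> y t \<and> y t \<le> t \<and> \<bar>V t\<bar> \<le> K \<and> \<mu> * (y t)\<^sup>2 / t\<^sup>2 - \<epsilon> \<le> V t\<rbrakk>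
    \<Longrightarrow> y 1 < d \<and> \<bar>y' 1\<bar> < d"
    using nonneg_solution_start_small[OF assms(1,2) d] by metis
  have "\<exists>x\<in>{s+l..s+(l+(T-1))}. v x < 0"
    if v: "reduced_profile \<mu> K \<epsilon> v v' V" and s: "s > 0" and E: "1 + s\<^sup>2 \<le> 18 * ((v s)\<^sup>2 + (v' s)\<^sup>2)"
    for v v' V s
  proof (rule ccontr)
    assume "\<not> ?thesis"
    then have nonneg: "0 \<le> v x" if "x \<in> {s+l..s+(l+(T-1))}" for x using that by (meson not_less)
    define a where "a = s + l"
    have a: "a > 1" using s assms by (simp add: a_def)
    have "v (a - 1 + 1) / a < d \<and> \<bar>v' (a - 1 + 1) / a\<bar> < d"
    proof (rule small[where y = "\<lambda>t. v (a - 1 + t) / a" and y' = "\<lambda>t. v' (a - 1 + t) / a"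
          and V = "\<lambda>t. V (a - 1 + t)"])
      fix t assume t: "t \<in> {1..T}"
      then have r: "a - 1 + t > 0" "a - 1 + t \<in> {s+l..s+(l+(T-1))}" using a by (auto simp: a_def)
      have rat: "a - 1 + t \<le> a * t" using a t mult_nonneg_nonneg[of "a - 1" "t - 1"]
        by (simp add: algebra_simps)
      have *: "(v has_real_derivative v' (a - 1 + t)) (at (a - 1 + t))"
        "(v' has_real_derivative - V (a - 1 + t) * v (a - 1 + t)) (at (a - 1 + t))"
        "\<bar>v (a - 1 + t)\<bar> \<le> a - 1 + t" "\<bar>V (a - 1 + t)\<bar> \<le> K"
        "\<mu> * (v (a - 1 + t))\<^sup>2 / (a - 1 + t)\<^sup>2 - \<epsilon> \<le> V (a - 1 + t)"
        using v r(1) unfolding reduced_profile_def by blast+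
      have shift: "((\<lambda>t. f (a - 1 + t)) has_real_derivative D) (at t)"
        if "(f has_real_derivative D) (at (a - 1 + t))" for f D
        using DERIV_shift[of f D t "a - 1"] that by (simp add: add.commute)
      have "\<mu> * (v (a - 1 + t) / a)\<^sup>2 / t\<^sup>2 = \<mu> * (v (a - 1 + t))\<^sup>2 / (a * t)\<^sup>2"
        by (simp add: power_divide power_mult_distrib)
      also have "\<dots> \<le> \<mu> * (v (a - 1 + t))\<^sup>2 / (a - 1 + t)\<^sup>2"
        using assms rat r(1) a t
        by (intro divide_left_mono power_mono mult_pos_pos zero_less_power) auto
      finally have "\<mu> * (v (a - 1 + t) / a)\<^sup>2 / t\<^sup>2 - \<epsilon> \<le> V (a - 1 + t)" using *(5) by linarith
      moreover have "v (a - 1 + t) / a \<le> t" using *(3) rat a by (simp add: field_simps)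
      moreover have "((\<lambda>t. v (a - 1 + t) / a) has_real_derivative v' (a - 1 + t) / a) (at t)"
        by (rule DERIV_cdivide[OF shift[OF *(1)]])
      moreover have "((\<lambda>t. v' (a - 1 + t) / a) has_real_derivative
          - V (a - 1 + t) * (v (a - 1 + t) / a)) (at t)"
        using DERIV_cdivide[OF shift[OF *(2)], of a] by simp
      moreover have "0 \<le> v (a - 1 + t) / a" using nonneg[OF r(2)] a by simp
      ultimately show "((\<lambda>t. v (a - 1 + t) / a) has_real_derivative v' (a - 1 + t) / a) (at t) \<and>
        ((\<lambda>t. v' (a - 1 + t) / a) has_real_derivative - V (a - 1 + t) * (v (a - 1 + t) / a)) (at t) \<and>
        0 \<le> v (a - 1 + t) / a \<and> v (a - 1 + t) / a \<le> t \<and> \<bar>V (a - 1 + t)\<bar> \<le> K \<and>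
        \<mu> * (v (a - 1 + t) / a)\<^sup>2 / t\<^sup>2 - \<epsilon> \<le> V (a - 1 + t)"
        using *(4) by blast
    qed
    moreover have "0 \<le> v a" using nonneg[of a] T by (simp add: a_def)
    ultimately have ab: "\<bar>v a\<bar> < d * a" "\<bar>v' a\<bar> < d * a" using a by (auto simp: field_simps)
    have "\<bar>v a\<bar>\<^sup>2 < (d * a)\<^sup>2" "\<bar>v' a\<bar>\<^sup>2 < (d * a)\<^sup>2"
      by (rule power_strict_mono[OF ab(1)] power_strict_mono[OF ab(2)]; simp)+
    then have up: "(v a)\<^sup>2 + (v' a)\<^sup>2 < 2 * d\<^sup>2 * a\<^sup>2" by (simp add: power_mult_distrib)
    have "(1 + s\<^sup>2) / 18 * exp (- (1 + K) * l) \<le> ((v s)\<^sup>2 + (v' s)\<^sup>2) * exp (- (1 + K) * (a - s))"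
      unfolding a_def using E by (intro mult_mono) auto
    also have "\<dots> \<le> (v a)\<^sup>2 + (v' a)\<^sup>2"
      using v s a assms by (intro energy_decay_bound[where V = V]) (auto simp: reduced_profile_def a_def)
    finally have low: "(1 + s\<^sup>2) / 18 * exp (- (1 + K) * l) \<le> (v a)\<^sup>2 + (v' a)\<^sup>2" .
    have "a\<^sup>2 \<le> 2 * (l\<^sup>2 * (1 + s\<^sup>2))"
    proof -
      have "a\<^sup>2 \<le> 2 * s\<^sup>2 + 2 * l\<^sup>2"
        using sum_squares_bound[of s l] by (simp add: a_def power2_sum)
      also have "\<dots> \<le> 2 * (l\<^sup>2 * (1 + s\<^sup>2))"
        using assms mult_right_mono[of 1 "l\<^sup>2" "s\<^sup>2"] by (simp add: one_le_power algebra_simps)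
      finally show ?thesis .
    qed
    then have "2 * d\<^sup>2 * a\<^sup>2 \<le> 2 * d\<^sup>2 * (2 * (l\<^sup>2 * (1 + s\<^sup>2)))" by (intro mult_left_mono) auto
    also have "\<dots> = 4 / 81 * (1 + s\<^sup>2) * exp (- (1 + K) * l)"
      using assms by (simp add: d2 field_simps)
    also have "\<dots> \<le> (1 + s\<^sup>2) / 18 * exp (- (1 + K) * l)"
      by (intro mult_right_mono) auto
    finally show False using up low by linarith
  qed
  then show ?thesis using T by (intro exI[of _ "T - 1"]) (auto intro!: exI[of _ \<epsilon>])
qed

text \<open>Consecutive windows, each as long as the distance from \<open>s\<close> already covered requires, all contain
  both signs: the equation is invariant under \<open>v \<mapsto> - v\<close>, so a window with a negative value also
  contains a positive one. Only \<open>P + 1\<close> windows are needed, hence one error \<open>\<epsilon>\<close> serves for all.\<close>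

lemma reduced_profile_oscillates:
  fixes \<mu> K :: real and P :: nat
  assumes "\<mu> > 0" "K \<ge> 0"
  shows "\<exists>\<epsilon>>0. \<forall>v v' V r0. reduced_profile \<mu> K \<epsilon> v v' V \<longrightarrow> r0 > 0 \<longrightarrow> r0 / 2 \<le> \<bar>v r0\<bar> \<longrightarrow>
    (\<exists>p. 0 < p 0 \<and> (\<forall>j\<le>P. p j < p (Suc j) \<and> v (p j) * v (p (Suc j)) < 0))"
proof -
  have "\<forall>l\<in>{1..}. \<exists>L \<epsilon>. L > 0 \<and> \<epsilon> > 0 \<and> (\<forall>v v' V s. reduced_profile \<mu> K \<epsilon> v v' V \<longrightarrow> s > 0 \<longrightarrow>
    1 + s\<^sup>2 \<le> 18 * ((v s)\<^sup>2 + (v' s)\<^sup>2) \<longrightarrow> (\<exists>x\<in>{s+l..s+(l+L)}. v x < 0))"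
    using reduced_profile_negative_in_window[OF assms] by (meson atLeast_iff)
  then obtain L e where Le: "\<And>l. l \<ge> 1 \<Longrightarrow> L l > 0" "\<And>l. l \<ge> 1 \<Longrightarrow> e l > 0"
    and neg: "\<And>l v v' V s. l \<ge> 1 \<Longrightarrow> reduced_profile \<mu> K (e l) v v' V \<Longrightarrow> s > 0 \<Longrightarrow>
      1 + s\<^sup>2 \<le> 18 * ((v s)\<^sup>2 + (v' s)\<^sup>2) \<Longrightarrow> \<exists>x\<in>{s+l..s+(l+L l)}. v x < 0"
    unfolding bchoice_iff by (metis atLeast_iff)
  \<comment> \<open>\<open>tau i\<close> is the distance from \<open>s\<close> to the beginning of window \<open>i\<close>.\<close>
  define tau where "tau = rec_nat 1 (\<lambda>_ l. l + L l)"
  have tau_Suc: "tau (Suc i) = tau i + L (tau i)" for i by (simp add: tau_def)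
  have tau1: "tau i \<ge> 1" for i
  proof (induction i)
    case (Suc i) then show ?case using Le(1)[of "tau i"] by (simp add: tau_Suc)
  qed (simp add: tau_def)
  define \<epsilon> where "\<epsilon> = Min ((\<lambda>i. e (tau i)) ` {..P})"
  have "\<epsilon> > 0" using Le(2) tau1 by (simp add: \<epsilon>_def)
  moreover have "\<exists>p. 0 < p 0 \<and> (\<forall>j\<le>P. p j < p (Suc j) \<and> v (p j) * v (p (Suc j)) < 0)"
    if v: "reduced_profile \<mu> K \<epsilon> v v' V" and r0: "r0 > 0" "r0 / 2 \<le> \<bar>v r0\<bar>" for v v' V r0
  proof -
    obtain s where s: "s > 0" "1 + s\<^sup>2 \<le> 18 * ((v s)\<^sup>2 + (v' s)\<^sup>2)"
      using reduced_profile_energetic_start[OF v r0] by blast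
    have vi: "reduced_profile \<mu> K (e (tau i)) v v' V" if "i \<le> P" for i
    proof -
      have "\<epsilon> \<le> e (tau i)" using that by (simp add: \<epsilon>_def)
      then show ?thesis using v unfolding reduced_profile_def by force
    qed
    have "\<exists>x\<in>{s + tau i..s + tau (Suc i)}. v x < 0" if "i \<le> P" for i
      using neg[OF tau1 vi[OF that] s] by (simp add: tau_Suc)
    moreover have "\<exists>x\<in>{s + tau i..s + tau (Suc i)}. v x > 0" if "i \<le> P" for i
      using neg[OF tau1 reduced_profile_uminus[OF vi[OF that]] s(1)] s(2) by (simp add: tau_Suc)
    ultimately obtain p where "s + tau 0 \<le> p 0"
      "\<forall>j\<le>P. p j < p (Suc j) \<and> v (p j) * v (p (Suc j)) < 0"
      using alternating_points[of P "\<lambda>i. s + tau i" v] by blast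
    moreover have "0 < s + tau 0" using s tau1[of 0] by linarith
    ultimately show ?thesis by (intro exI[of _ p]) auto
  qed
  ultimately show ?thesis by blast
qed

section \<open>Radial functions\<close>

lemma partial_deriv_along_line:
  fixes u :: "'a::euclidean_space \<Rightarrow> real"
  assumes "u differentiable (at (x + t *\<^sub>R b))"
  shows "((\<lambda>s. u (x + s *\<^sub>R b)) has_real_derivative partial_deriv b u (x + t *\<^sub>R b)) (at t)"
proof -
  define D where "D = frechet_derivative u (at (x + t *\<^sub>R b))"
  have D: "(u has_derivative D) (at (x + t *\<^sub>R b))"
    using assms frechet_derivative_works unfolding D_def by blast
  have "((\<lambda>s. x + s *\<^sub>R b) has_derivative (\<lambda>h. h *\<^sub>R b)) (at t)"
    by (auto intro!: derivative_eq_intros)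
  from has_derivative_compose[OF this D]
  have "((\<lambda>s. u (x + s *\<^sub>R b)) has_derivative (\<lambda>h. D (h *\<^sub>R b))) (at t)" .
  moreover have "(\<lambda>h. D (h *\<^sub>R b)) = (*) (D b)"
    using linear_scale[OF has_derivative_linear[OF D]] by (auto simp: mult.commute)
  ultimately show ?thesis
    by (simp add: has_field_derivative_def partial_deriv_def D_def)
qed

lemma C_k_real_2_D:
  assumes "C_k_real 2 u"
  shows "u differentiable (at x)" and "b \<in> Basis \<Longrightarrow> partial_deriv b u differentiable (at x)"
  using assms by (auto simp: numeral_2_eq_2)

text \<open>Along the line through \<open>r e\<close> in the direction \<open>b\<close>, orthogonal to \<open>e\<close>, a radial function depends on
  the parameter \<open>t\<close> only through \<open>\<surd>(r\<^sup>2 + t\<^sup>2)\<close>. Two applications of the chain rule give the claim,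
  since this square root has derivative 0 at \<open>t = 0\<close>.\<close>

lemma radial_tangential_second_derivative:
  fixes u :: "'a::euclidean_space \<Rightarrow> real"
  assumes C2: "C_k_real 2 u" and rad: "radial u" and e: "e \<in> Basis" and b: "b \<in> Basis" "b \<noteq> e"
    and r: "r > 0"
  shows "partial_deriv b (partial_deriv b u) (r *\<^sub>R e) = partial_deriv e u (r *\<^sub>R e) / r"
proof -
  define g where "g s = partial_deriv e u (s *\<^sub>R e)" for s
  define \<phi> where "\<phi> t = sqrt (r\<^sup>2 + t\<^sup>2)" for t
  have pos: "r\<^sup>2 + t\<^sup>2 > 0" for t using r by (simp add: add_pos_nonneg)
  have \<phi>pos: "\<phi> t > 0" for t using pos by (simp add: \<phi>_def)
  have \<phi>0: "\<phi> 0 = r" using r by (simp add: \<phi>_def)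
  have d\<phi>: "(\<phi> has_real_derivative t / \<phi> t) (at t)" for t
    unfolding \<phi>_def using pos[of t]
    by (auto intro!: derivative_eq_intros simp: field_simps)
  have radius: "norm (r *\<^sub>R e + t *\<^sub>R b) = norm (\<phi> t *\<^sub>R e)" for t
    using e b \<phi>pos[of t]
    by (simp add: norm_eq_sqrt_inner inner_add_left inner_add_right inner_Basis \<phi>_def power2_eq_square)
  have line: "((\<lambda>s. h (0 + s *\<^sub>R e)) has_real_derivative partial_deriv e h (0 + t *\<^sub>R e)) (at t)"
    if "\<And>x. h differentiable (at x)" for h t
    by (rule partial_deriv_along_line) (rule that)
  have f': "((\<lambda>s. u (s *\<^sub>R e)) has_real_derivative g t) (at t)" for t
    using line[OF C_k_real_2_D(1)[OF C2], of t] by (simp add: g_def)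
  have g': "(g has_real_derivative partial_deriv e (partial_deriv e u) (t *\<^sub>R e)) (at t)" for t
    using line[OF C_k_real_2_D(2)[OF C2 e], of t] by (simp add: g_def[abs_def])
  have first: "partial_deriv b u (r *\<^sub>R e + t *\<^sub>R b) = g (\<phi> t) * (t / \<phi> t)" for t
  proof -
    have "(\<lambda>t. u (r *\<^sub>R e + t *\<^sub>R b)) = (\<lambda>t. u (\<phi> t *\<^sub>R e))"
      using rad radius unfolding radial_def by blast
    moreover have "((\<lambda>t. u (\<phi> t *\<^sub>R e)) has_real_derivative g (\<phi> t) * (t / \<phi> t)) (at t)"
      by (rule DERIV_chain2[OF f' d\<phi>])
    ultimately show ?thesis
      using partial_deriv_along_line[of u "r *\<^sub>R e" t b, OF C_k_real_2_D(1)[OF C2]] DERIV_unique by metis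
  qed
  have "((\<lambda>t. g (\<phi> t) * (t / \<phi> t)) has_real_derivative g r / r) (at 0)"
    using r
    by (auto intro!: derivative_eq_intros DERIV_chain2[OF g' d\<phi>] d\<phi> simp: \<phi>0 power2_eq_square)
  moreover have "((\<lambda>t. g (\<phi> t) * (t / \<phi> t)) has_real_derivative
      partial_deriv b (partial_deriv b u) (r *\<^sub>R e)) (at 0)"
    using partial_deriv_along_line[of "partial_deriv b u" "r *\<^sub>R e" 0 b, OF C_k_real_2_D(2)[OF C2 b(1)]]
    by (simp add: first)
  ultimately show ?thesis using DERIV_unique g_def by metis
qed

lemma laplacian_radial:
  fixes u :: "'a::euclidean_space \<Rightarrow> real"
  assumes "C_k_real 2 u" "radial u" and e: "e \<in> Basis" and "r > 0"
  shows "laplacian u (r *\<^sub>R e) = partial_deriv e (partial_deriv e u) (r *\<^sub>R e)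
    + (DIM('a) - 1) * partial_deriv e u (r *\<^sub>R e) / r"
proof -
  have "laplacian u (r *\<^sub>R e) = partial_deriv e (partial_deriv e u) (r *\<^sub>R e)
      + (\<Sum>b\<in>Basis - {e}. partial_deriv b (partial_deriv b u) (r *\<^sub>R e))"
    unfolding laplacian_def using e by (simp add: sum.remove)
  also have "(\<Sum>b\<in>Basis - {e}. partial_deriv b (partial_deriv b u) (r *\<^sub>R e))
      = (\<Sum>b\<in>Basis - {e}. partial_deriv e u (r *\<^sub>R e) / r)"
    using radial_tangential_second_derivative[OF assms(1,2) e _ _ \<open>r > 0\<close>] by (intro sum.cong) auto
  finally show ?thesis using e by (simp add: card_Diff_singleton)
qed

text \<open>In dimension three the substitution \<open>v r = r u(r)\<close> removes the first-order term of the radial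
  Laplacian \<open>u'' + 2 u'/r\<close>.\<close>

lemma radial_3d_reduction:
  fixes u :: "real^3 \<Rightarrow> real"
  assumes C2: "C_k_real 2 u" and rad: "radial u" and e: "e \<in> Basis" and r: "r > 0"
  defines "v' \<equiv> \<lambda>r. u (r *\<^sub>R e) + r * partial_deriv e u (r *\<^sub>R e)"
  shows "((\<lambda>r. r * u (r *\<^sub>R e)) has_real_derivative v' r) (at r)"
    and "(v' has_real_derivative r * laplacian u (r *\<^sub>R e)) (at r)"
proof -
  have line: "((\<lambda>s. h (s *\<^sub>R e)) has_real_derivative partial_deriv e h (t *\<^sub>R e)) (at t)"
    if "\<And>x. h differentiable (at x)" for h t
    using partial_deriv_along_line[of h 0 t e] that by simp
  note d1 = line[OF C_k_real_2_D(1)[OF C2]] and d2 = line[OF C_k_real_2_D(2)[OF C2 e]]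
  show "((\<lambda>r. r * u (r *\<^sub>R e)) has_real_derivative v' r) (at r)"
    unfolding v'_def by (auto intro!: derivative_eq_intros d1)
  show "(v' has_real_derivative r * laplacian u (r *\<^sub>R e)) (at r)"
    unfolding v'_def using r
    by (auto intro!: derivative_eq_intros d1 d2 simp: laplacian_radial[OF C2 rad e r] field_simps)
qed

text \<open>The sublevel set is closed and has full measure, so it is the whole space.\<close>

lemma Linf_norm_le_imp_bounded:
  fixes u :: "'a::euclidean_space \<Rightarrow> real"
  assumes "continuous_on UNIV u" "Linf_norm u \<le> ereal c"
  shows "\<bar>u x\<bar> \<le> c"
proof -
  have "closed {x. \<bar>u x\<bar> \<le> c}" using assms(1) by (intro closed_Collect_le continuous_intros)
  moreover have "AE x in lborel. \<bar>u x\<bar> \<le> c"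
    using esssup_AE[of "\<lambda>x. ereal \<bar>u x\<bar>" lborel] assms(2)
    unfolding Linf_norm_def by (elim eventually_mono) (meson ereal_less_eq(3) order_trans)
  then have "AE x in lebesgue. x \<in> {x. \<bar>u x\<bar> \<le> c}" by (simp add: AE_completion)
  ultimately show ?thesis using mem_closed_if_AE_lebesgue by blast
qed

lemma radial_sign_changes_ge:
  fixes u :: "'a::euclidean_space \<Rightarrow> real"
  assumes rad: "radial u" and e: "norm e = 1" and p: "0 < p 0"
    "\<And>j. j < k \<Longrightarrow> p j < p (Suc j) \<and> u (p j *\<^sub>R e) * u (p (Suc j) *\<^sub>R e) < 0"
  shows "enat k \<le> sign_changes u"
proof -
  have pos: "p j > 0" if "j \<le> k" for j
    using that
  proof (induction j)
    case (Suc j) then show ?case using p(2)[of j] by fastforce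
  qed (use p in simp)
  have "u y = u (p j *\<^sub>R e)" if "norm y = p j" "j \<le> k" for y j
    using rad that pos[OF that(2)] e unfolding radial_def by simp
  then have "has_sign_changes u k"
    unfolding has_sign_changes_def using p by (intro exI[of _ p]) auto
  then show ?thesis unfolding sign_changes_def by (auto intro: SUP_upper)
qed

section \<open>The Liouville theorem for the system\<close>

text \<open>Since \<open>M\<close> bounds all components and \<open>u j\<close> nearly attains it, the profile rescaled by
  \<open>u j(r) \<mapsto> u j(r/M)/M\<close>, which leaves the cubic system invariant, is bounded by 1 and of size
  one half somewhere. The other components only enter through the potential, where they contribute
  a term between \<open>- N \<epsilon>\<^sub>0\<close> and \<open>N (\<beta> + 1)\<close> after rescaling. The hypothesis \<open>osc\<close> is the conclusion of
  \<open>reduced_profile_oscillates\<close>: there \<open>\<epsilon>\<close> is found before the couplings and the solution are given.\<close>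

lemma radial_solution_oscillates:
  fixes u :: "nat \<Rightarrow> real^3 \<Rightarrow> real" and b :: "nat \<Rightarrow> nat \<Rightarrow> real"
  assumes j: "j \<in> {1..N}" and mu: "\<mu> > 0" and beta: "\<beta> \<ge> 0"
    and osc: "\<And>v v' V r0. reduced_profile \<mu> (\<mu> + N * (\<beta> + 1)) \<epsilon> v v' V \<Longrightarrow> r0 > 0 \<Longrightarrow> r0 / 2 \<le> \<bar>v r0\<bar> \<Longrightarrow>
      \<exists>p. 0 < p 0 \<and> (\<forall>k\<le>P. p k < p (Suc k) \<and> v (p k) * v (p (Suc k)) < 0)"
    and b: "\<And>i. i \<in> {1..N} - {j} \<Longrightarrow> b i j \<in> {- \<epsilon>\<^sub>0..\<beta>}" and eps: "\<epsilon>\<^sub>0 \<le> 1" "\<epsilon>\<^sub>0 \<ge> 0" "N * \<epsilon>\<^sub>0 \<le> \<epsilon>"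
    and eq: "\<And>x. - laplacian (u j) x = \<mu> * u j x ^ 3 + (\<Sum>i\<in>{1..N} - {j}. b i j * (u i x)\<^sup>2 * u j x)"
    and C2: "C_k_real 2 (u j)" and rad: "radial (u j)"
    and M: "M > 0" "\<And>i x. i \<in> {1..N} \<Longrightarrow> \<bar>u i x\<bar> \<le> M" and x: "M / 2 < \<bar>u j x\<bar>"
  shows "enat (Suc P) \<le> sign_changes (u j)"
proof -
  define e :: "real^3" where "e = axis 1 1"
  have e: "e \<in> Basis" "norm e = 1" by (auto simp: e_def axis_in_Basis_iff)
  have cont: "continuous_on UNIV (u j)"
    using C_k_real_2_D(1)[OF C2] differentiable_imp_continuous_within
    by (force simp: continuous_on_eq_continuous_within)
  have "\<exists>r>0. M / 2 < \<bar>u j (r *\<^sub>R e)\<bar>"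
  proof -
    have cont_ray: "continuous_on UNIV (\<lambda>r. u j (r *\<^sub>R e))"
      by (rule continuous_on_compose2[OF cont]) (intro continuous_on_scaleR continuous_on_id continuous_on_const, simp)
    have "open {r. M / 2 < \<bar>u j (r *\<^sub>R e)\<bar>}"
      by (rule open_Collect_less[OF continuous_on_const continuous_on_rabs[OF cont_ray]])
    moreover have "norm x \<in> {r. M / 2 < \<bar>u j (r *\<^sub>R e)\<bar>}"
    proof -
      have "u j (norm x *\<^sub>R e) = u j x"
        by (rule rad[unfolded radial_def, rule_format]) (simp add: e)
      then show ?thesis using x by simp
    qed
    \<comment> \<open>The norm of \<open>x\<close> may be 0, hence the step outwards to a positive radius.\<close>
    ultimately obtain \<delta> where "\<delta> > 0" "ball (norm x) \<delta> \<subseteq> {r. M / 2 < \<bar>u j (r *\<^sub>R e)\<bar>}"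
      using open_contains_ball by blast
    then have "norm x + \<delta> / 2 > 0 \<and> M / 2 < \<bar>u j ((norm x + \<delta> / 2) *\<^sub>R e)\<bar>"
      by (auto simp: subset_iff dist_real_def add_nonneg_pos)
    then show ?thesis by blast
  qed
  then obtain r1 where r1: "r1 > 0" "M / 2 < \<bar>u j (r1 *\<^sub>R e)\<bar>" by blast
  \<comment> \<open>The rescaled reduced profile: \<open>r\<close> times \<open>u j(r/M)/M\<close>, and its potential.\<close>
  define S where "S y = (\<Sum>i\<in>{1..N} - {j}. b i j * (u i y)\<^sup>2)" for y
  define V where "V r = (\<mu> * (u j ((r / M) *\<^sub>R e))\<^sup>2 + S ((r / M) *\<^sub>R e)) / M\<^sup>2" for r
  define v where "v r = r / M * u j ((r / M) *\<^sub>R e)" for r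
  define w' where "w' r = u j (r *\<^sub>R e) + r * partial_deriv e (u j) (r *\<^sub>R e)" for r
  have lap: "laplacian (u j) y = - (\<mu> * (u j y)\<^sup>2 + S y) * u j y" for y
  proof -
    have "- laplacian (u j) y = \<mu> * u j y ^ 3 + S y * u j y"
      unfolding eq S_def sum_distrib_right ..
    then show ?thesis by (simp add: power3_eq_cube power2_eq_square algebra_simps)
  qed
  have coupling: "- \<epsilon>\<^sub>0 * M\<^sup>2 \<le> b i j * (u i y)\<^sup>2" "\<bar>b i j * (u i y)\<^sup>2\<bar> \<le> (\<beta> + 1) * M\<^sup>2"
    if i: "i \<in> {1..N} - {j}" for i y
  proof -
    have sq: "(u i y)\<^sup>2 \<le> M\<^sup>2" using M i by (simp add: abs_le_square_iff[symmetric])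
    have "\<epsilon>\<^sub>0 * (u i y)\<^sup>2 \<le> \<epsilon>\<^sub>0 * M\<^sup>2" using sq eps by (intro mult_left_mono) auto
    moreover have "- \<epsilon>\<^sub>0 * (u i y)\<^sup>2 \<le> b i j * (u i y)\<^sup>2" using b[OF i] by (intro mult_right_mono) auto
    ultimately show "- \<epsilon>\<^sub>0 * M\<^sup>2 \<le> b i j * (u i y)\<^sup>2" by simp
    have "\<bar>b i j\<bar> \<le> \<beta> + 1" using b[OF i] eps beta by auto
    then show "\<bar>b i j * (u i y)\<^sup>2\<bar> \<le> (\<beta> + 1) * M\<^sup>2"
      unfolding abs_mult using sq beta by (intro mult_mono) auto
  qed
  have card: "card ({1..N} - {j}) \<le> N" using card_Diff1_le[of "{1..N}" j] by simp
  have S_low: "- \<epsilon> * M\<^sup>2 \<le> S y" for y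
  proof -
    have "real N * \<epsilon>\<^sub>0 * M\<^sup>2 \<le> \<epsilon> * M\<^sup>2" using eps by (intro mult_right_mono) auto
    moreover have "real (card ({1..N} - {j})) * (\<epsilon>\<^sub>0 * M\<^sup>2) \<le> real N * (\<epsilon>\<^sub>0 * M\<^sup>2)"
      using card eps by (intro mult_right_mono) auto
    moreover have "real (card ({1..N} - {j})) * (- \<epsilon>\<^sub>0 * M\<^sup>2) \<le> S y"
      unfolding S_def by (intro sum_bounded_below coupling)
    ultimately show ?thesis by (simp add: algebra_simps)
  qed
  have S_abs: "\<bar>S y\<bar> \<le> N * (\<beta> + 1) * M\<^sup>2" for y
  proof -
    have "\<bar>S y\<bar> \<le> (\<Sum>i\<in>{1..N} - {j}. \<bar>b i j * (u i y)\<^sup>2\<bar>)" unfolding S_def by (rule sum_abs)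
    also have "\<dots> \<le> real (card ({1..N} - {j})) * ((\<beta> + 1) * M\<^sup>2)"
      by (intro sum_bounded_above coupling)
    also have "\<dots> \<le> real N * ((\<beta> + 1) * M\<^sup>2)" using card beta by (intro mult_right_mono) auto
    finally show ?thesis by (simp add: mult.assoc)
  qed
  have "reduced_profile \<mu> (\<mu> + N * (\<beta> + 1)) \<epsilon> v (\<lambda>r. w' (r / M) / M) V"
    unfolding reduced_profile_def
  proof (intro allI impI conjI)
    fix r :: real assume r: "r > 0"
    then have rM: "r / M > 0" using M by simp
    have scale: "((\<lambda>r. r / M) has_real_derivative 1 / M) (at r)"
      by (rule DERIV_cdivide[OF DERIV_ident])
    note red = radial_3d_reduction[OF C2 rad e(1) rM]
    show "(v has_real_derivative w' (r / M) / M) (at r)"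
      using DERIV_chain2[OF red(1) scale] by (simp add: v_def[abs_def] w'_def)
    have "(w' has_real_derivative r / M * laplacian (u j) ((r / M) *\<^sub>R e)) (at (r / M))"
      using red(2) unfolding w'_def .
    from DERIV_cdivide[OF DERIV_chain2[OF this scale], of M]
    show "((\<lambda>r. w' (r / M) / M) has_real_derivative - V r * v r) (at r)"
      by (rule DERIV_cong) (use M in \<open>simp add: lap V_def v_def field_simps power2_eq_square\<close>)
    have uM: "\<bar>u j y\<bar> \<le> M" for y using M j by auto
    show "\<bar>v r\<bar> \<le> r"
    proof -
      have "\<bar>v r\<bar> \<le> r / M * M" unfolding v_def abs_mult using rM uM by (intro mult_mono) auto
      then show ?thesis using M by simp
    qed
    have sq: "(u j y)\<^sup>2 \<le> M\<^sup>2" for y using uM M(1) by (simp add: abs_le_square_iff[symmetric])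
    have "\<bar>\<mu> * (u j y)\<^sup>2 + S y\<bar> \<le> \<mu> * M\<^sup>2 + N * (\<beta> + 1) * M\<^sup>2" for y
    proof -
      have "\<bar>\<mu> * (u j y)\<^sup>2\<bar> \<le> \<mu> * M\<^sup>2" using mu sq by (simp add: abs_mult)
      then show ?thesis using S_abs[of y] by linarith
    qed
    then show "\<bar>V r\<bar> \<le> \<mu> + N * (\<beta> + 1)"
      using M(1) by (simp add: V_def divide_le_eq algebra_simps)
    have "\<mu> * (v r)\<^sup>2 / r\<^sup>2 - \<epsilon> = (\<mu> * (u j ((r / M) *\<^sub>R e))\<^sup>2 - \<epsilon> * M\<^sup>2) / M\<^sup>2"
      using r M(1) by (simp add: v_def field_simps power_mult_distrib)
    also have "\<dots> \<le> V r"
      unfolding V_def using S_low[of "(r / M) *\<^sub>R e"] by (intro divide_right_mono) auto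
    finally show "\<mu> * (v r)\<^sup>2 / r\<^sup>2 - \<epsilon> \<le> V r" .
  qed
  moreover have "r1 * M > 0" using r1 M by simp
  moreover have "r1 * M / 2 \<le> \<bar>v (r1 * M)\<bar>"
  proof -
    have "r1 * (M / 2) \<le> r1 * \<bar>u j (r1 *\<^sub>R e)\<bar>" using r1 by (intro mult_left_mono) auto
    then show ?thesis using r1 M by (simp add: v_def abs_mult)
  qed
  ultimately obtain p where p: "0 < p 0" "\<And>k. k \<le> P \<Longrightarrow> p k < p (Suc k) \<and> v (p k) * v (p (Suc k)) < 0"
    using osc by blast
  have pos: "p k > 0" if "k \<le> Suc P" for k
    using that
  proof (induction k)
    case (Suc k) then show ?case using p(2)[of k] by fastforce
  qed (use p in simp)
  show ?thesis
  proof (rule radial_sign_changes_ge[OF rad e(2), where p = "\<lambda>k. p k / M"])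
    show "0 < p 0 / M" using p M by simp
    fix k assume k: "k < Suc P"
    then have *: "p k < p (Suc k)" "v (p k) * v (p (Suc k)) < 0" using p(2)[of k] by auto
    have "0 < p k / M * (p (Suc k) / M)" using pos[of k] pos[of "Suc k"] k M by simp
    moreover have "v (p k) * v (p (Suc k)) =
        (p k / M * (p (Suc k) / M)) * (u j ((p k / M) *\<^sub>R e) * u j ((p (Suc k) / M) *\<^sub>R e))"
      by (simp add: v_def)
    ultimately have "u j ((p k / M) *\<^sub>R e) * u j ((p (Suc k) / M) *\<^sub>R e) < 0"
      using *(2) by (metis mult_less_0_iff not_less_iff_gr_or_eq)
    then show "p k / M < p (Suc k) / M \<and> u j ((p k / M) *\<^sub>R e) * u j ((p (Suc k) / M) *\<^sub>R e) < 0"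
      using * M by (simp add: divide_strict_right_mono)
  qed
qed

theorem theorem1p3:
  fixes N :: nat and \<mu> :: "nat \<Rightarrow> real" and P :: "nat \<Rightarrow> nat" and \<beta> :: real
  assumes "N > 0"
    and "\<And>j. j \<in> {1..N} \<Longrightarrow> \<mu> j > 0"
    and "\<beta> \<ge> 0"
  shows "\<exists>\<epsilon>\<^sub>0>0. \<forall>b :: nat \<Rightarrow> nat \<Rightarrow> real.
    (\<forall>i\<in>{1..N}. \<forall>j\<in>{1..N}. i \<noteq> j \<longrightarrow> b i j \<in> {-\<epsilon>\<^sub>0..\<beta>}) \<longrightarrow>
    \<not> (\<exists>u :: nat \<Rightarrow> real^3 \<Rightarrow> real.
         (\<exists>j\<in>{1..N}. u j \<noteq> (\<lambda>x. 0)) \<and>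
         (\<forall>j\<in>{1..N}.
            (\<forall>x. - laplacian (u j) x =
               \<mu> j * u j x ^ 3 + (\<Sum>i\<in>{1..N} - {j}. b i j * (u i x)\<^sup>2 * u j x)) \<and>
            C_k_real 2 (u j) \<and> radial (u j) \<and>
            (u j = (\<lambda>x. 0) \<or> sign_changes (u j) \<le> enat (P j)) \<and>
            Linf_norm (u j) \<le> 1))"
proof -
  define K where "K j = \<mu> j + real N * (\<beta> + 1)" for j
  have "\<forall>j\<in>{1..N}. \<exists>\<epsilon>>0. \<forall>v v' V r0. reduced_profile (\<mu> j) (K j) \<epsilon> v v' V \<longrightarrow> r0 > 0 \<longrightarrow>
      r0 / 2 \<le> \<bar>v r0\<bar> \<longrightarrow> (\<exists>p. 0 < p 0 \<and> (\<forall>k\<le>P j. p k < p (Suc k) \<and> v (p k) * v (p (Suc k)) < 0))"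
  proof
    fix j assume "j \<in> {1..N}"
    then have "\<mu> j > 0" "K j \<ge> 0" using assms(2)[of j] assms(3) by (auto simp: K_def intro!: add_nonneg_nonneg less_imp_le)
    then show "\<exists>\<epsilon>>0. \<forall>v v' V r0. reduced_profile (\<mu> j) (K j) \<epsilon> v v' V \<longrightarrow> r0 > 0 \<longrightarrow>
      r0 / 2 \<le> \<bar>v r0\<bar> \<longrightarrow> (\<exists>p. 0 < p 0 \<and> (\<forall>k\<le>P j. p k < p (Suc k) \<and> v (p k) * v (p (Suc k)) < 0))"
      by (rule reduced_profile_oscillates)
  qed
  then obtain \<epsilon> where \<epsilon>: "\<And>j. j \<in> {1..N} \<Longrightarrow> \<epsilon> j > 0"
    and osc: "\<And>j v v' V r0. j \<in> {1..N} \<Longrightarrow> reduced_profile (\<mu> j) (K j) (\<epsilon> j) v v' V \<Longrightarrow> r0 > 0 \<Longrightarrow>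
      r0 / 2 \<le> \<bar>v r0\<bar> \<Longrightarrow> \<exists>p. 0 < p 0 \<and> (\<forall>k\<le>P j. p k < p (Suc k) \<and> v (p k) * v (p (Suc k)) < 0)"
    unfolding bchoice_iff by metis
  define m where "m = Min (\<epsilon> ` {1..N})"
  define \<epsilon>\<^sub>0 where "\<epsilon>\<^sub>0 = min 1 (m / N)"
  have "m > 0" using \<epsilon> assms(1) by (auto simp: m_def)
  then have \<epsilon>\<^sub>0: "\<epsilon>\<^sub>0 > 0" "\<epsilon>\<^sub>0 \<le> 1" using assms(1) by (auto simp: \<epsilon>\<^sub>0_def)
  have N\<epsilon>: "N * \<epsilon>\<^sub>0 \<le> \<epsilon> j" if "j \<in> {1..N}" for j
  proof -
    have "N * \<epsilon>\<^sub>0 \<le> m" using assms(1) by (simp add: \<epsilon>\<^sub>0_def min_def field_simps)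
    also have "m \<le> \<epsilon> j" using that by (simp add: m_def)
    finally show ?thesis .
  qed
  have False
    if b: "\<forall>i\<in>{1..N}. \<forall>j\<in>{1..N}. i \<noteq> j \<longrightarrow> b i j \<in> {-\<epsilon>\<^sub>0..\<beta>}"
      and nz: "\<exists>j\<in>{1..N}. u j \<noteq> (\<lambda>x. 0)"
      and sol: "\<forall>j\<in>{1..N}.
            (\<forall>x. - laplacian (u j) x =
               \<mu> j * u j x ^ 3 + (\<Sum>i\<in>{1..N} - {j}. b i j * (u i x)\<^sup>2 * u j x)) \<and>
            C_k_real 2 (u j) \<and> radial (u j) \<and>
            (u j = (\<lambda>x. 0) \<or> sign_changes (u j) \<le> enat (P j)) \<and>
            Linf_norm (u j) \<le> 1"
    for b :: "nat \<Rightarrow> nat \<Rightarrow> real" and u :: "nat \<Rightarrow> real^3 \<Rightarrow> real"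
  proof -
    have le1: "\<bar>u i x\<bar> \<le> 1" if i: "i \<in> {1..N}" for i x
    proof (rule Linf_norm_le_imp_bounded[of "u i"])
      have "C_k_real 2 (u i)" using sol i by blast
      then show "continuous_on UNIV (u i)"
        using C_k_real_2_D(1) differentiable_imp_continuous_within
        by (force simp: continuous_on_eq_continuous_within)
      show "Linf_norm (u i) \<le> ereal 1" using sol i unfolding one_ereal_def[symmetric] by blast
    qed
    \<comment> \<open>The component that nearly attains the common supremum is the one to be contradicted.\<close>
    define A where "A = (\<Union>i\<in>{1..N}. range (\<lambda>x. \<bar>u i x\<bar>))"
    define M where "M = Sup A"
    have bdd: "bdd_above A" unfolding A_def using le1 by (intro bdd_aboveI[of _ 1]) blast
    have upper: "\<bar>u i x\<bar> \<le> M" if "i \<in> {1..N}" for i x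
      unfolding M_def using that by (intro cSup_upper bdd) (unfold A_def, blast)
    obtain i x where ix: "i \<in> {1..N}" "u i x \<noteq> 0" using nz unfolding fun_eq_iff by blast
    then have M: "M > 0" using upper[of i x] by auto
    have "A \<noteq> {}" using ix by (auto simp: A_def)
    then obtain a where "a \<in> A" "M / 2 < a"
      using less_cSup_iff[OF _ bdd, of "M / 2"] M unfolding M_def by auto
    then obtain j y where j: "j \<in> {1..N}" and y: "M / 2 < \<bar>u j y\<bar>" by (auto simp: A_def)
    have "enat (Suc (P j)) \<le> sign_changes (u j)"
    proof (rule radial_solution_oscillates[where \<mu> = "\<mu> j" and \<epsilon> = "\<epsilon> j" and M = M])
      show "\<exists>p. 0 < p 0 \<and> (\<forall>k\<le>P j. p k < p (Suc k) \<and> v (p k) * v (p (Suc k)) < 0)"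
        if "reduced_profile (\<mu> j) (\<mu> j + real N * (\<beta> + 1)) (\<epsilon> j) v v' V" "0 < r0" "r0 / 2 \<le> \<bar>v r0\<bar>"
        for v v' V r0
        using osc[OF j] that unfolding K_def by blast
      show "b i j \<in> {-\<epsilon>\<^sub>0..\<beta>}" if "i \<in> {1..N} - {j}" for i
        using b j that by blast
      show "- laplacian (u j) x = \<mu> j * u j x ^ 3 + (\<Sum>i\<in>{1..N} - {j}. b i j * (u i x)\<^sup>2 * u j x)"
        "C_k_real 2 (u j)" "radial (u j)" for x
        using sol j by blast+
    qed (use j assms(2)[OF j] assms(3) \<epsilon>\<^sub>0 N\<epsilon>[OF j] M upper y in \<open>simp_all\<close>)
    moreover have "u j \<noteq> (\<lambda>x. 0)" using y M by auto
    then have "sign_changes (u j) \<le> enat (P j)" using sol j by blast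
    ultimately have "enat (Suc (P j)) \<le> enat (P j)" by (rule order_trans)
    then show False by simp
  qed
  note contra = this
  show ?thesis
  proof (rule exI[of _ \<epsilon>\<^sub>0], rule conjI, rule \<epsilon>\<^sub>0(1), intro allI impI notI, elim exE conjE)
    fix b :: "nat \<Rightarrow> nat \<Rightarrow> real" and u :: "nat \<Rightarrow> real^3 \<Rightarrow> real"
    assume "\<forall>i\<in>{1..N}. \<forall>j\<in>{1..N}. i \<noteq> j \<longrightarrow> b i j \<in> {-\<epsilon>\<^sub>0..\<beta>}"
      "\<exists>j\<in>{1..N}. u j \<noteq> (\<lambda>x. 0)"
      "\<forall>j\<in>{1..N}.
            (\<forall>x. - laplacian (u j) x =
               \<mu> j * u j x ^ 3 + (\<Sum>i\<in>{1..N} - {j}. b i j * (u i x)\<^sup>2 * u j x)) \<and>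
            C_k_real 2 (u j) \<and> radial (u j) \<and>
            (u j = (\<lambda>x. 0) \<or> sign_changes (u j) \<le> enat (P j)) \<and>
            Linf_norm (u j) \<le> 1"
    then show False by (rule contra)
  qed
qed

end
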